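(* Let $\mathcal{B}$ be the set of all points $(\alpha_0,\beta_0)\in\mathcal{D}$ for which the sequence $\beta_n$ $(n\ge0)$ produced by the Jacobi-Perron algorithm is bounded from above. Then $\mathcal{B}$ is a null set for the two-dimensional Lebesgue measure.
   Context: $\mathcal{D}=\{(x,y)\in\mathbf{R}^2: 0\le x\le y,\ 1\le y\}$. For real $x$ let $[x]$ be the greatest integer $\le x$ and $\{x\}=x-[x]$. For $(\alpha_0,\beta_0)\in\mathcal{D}$ the Jacobi-Perron algorithm (dimension 2) defines successively $\alpha_n=\{\beta_{n-1}\}/\{\alpha_{n-1}\}$ and $\beta_n=1/\{\alpha_{n-1}\}$ for $n\ge1$; the algorithm stops if $\{\alpha_{n-1}\}=0$. Membership in $\mathcal{B}$ means that $\beta_n$ is defined for all $n\ge0$ and $\sup_n\beta_n<\infty$. *)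

theory Defs
  imports "HOL-Analysis.Analysis"
begin

definition jp_domain :: "(real \<times> real) set" where
  "jp_domain = {(x, y). 0 \<le> x \<and> x \<le> y \<and> 1 \<le> y}"

text \<open>One step of the algorithm; \<open>None\<close> means that the algorithm stops.\<close>

definition jp_step :: "real \<times> real \<Rightarrow> (real \<times> real) option" where
  "jp_step = (\<lambda>(a, b). if frac a = 0 then None else Some (frac b / frac a, 1 / frac a))"

text \<open>\<open>jp_seq p n\<close> is \<open>Some (\<alpha>\<^sub>n, \<beta>\<^sub>n)\<close> for the starting point \<open>p = (\<alpha>\<^sub>0, \<beta>\<^sub>0)\<close>,
  or \<open>None\<close> if the algorithm has stopped before index \<open>n\<close>.\<close>

fun jp_seq :: "real \<times> real \<Rightarrow> nat \<Rightarrow> (real \<times> real) option" where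
  "jp_seq p 0 = Some p"
| "jp_seq p (Suc n) = Option.bind (jp_seq p n) jp_step"

text \<open>\<open>jp_beta p n\<close> is \<open>\<beta>\<^sub>n\<close>; it is meaningful only where \<open>jp_seq p n \<noteq> None\<close>.\<close>

definition jp_beta :: "real \<times> real \<Rightarrow> nat \<Rightarrow> real" where
  "jp_beta p n = snd (the (jp_seq p n))"

definition jp_bounded :: "(real \<times> real) set" where
  "jp_bounded = {p \<in> jp_domain. (\<forall>n. jp_seq p n \<noteq> None) \<and> bdd_above (range (jp_beta p))}"

end

theory Submission imports Defs
begin

text \<open>
  In the coordinates \<open>x = {\<alpha>}\<close>, \<open>y = {\<beta>}\<close> the algorithm is the map
  \<open>T (x, y) = ({y/x}, {1/x})\<close> of the unit square, and \<open>\<beta>\<^sub>n\<^sub>+\<^sub>1 = 1 / x\<^sub>n\<close>. So \<open>\<beta>\<^sub>n\<close> is bounded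
  exactly when some \<open>M\<close> satisfies \<open>x\<^sub>n \<ge> 1/M\<close> for all \<open>n\<close>, and the starting points in
  question are integer translates of points of the square whose orbits have this property. It
  suffices to show that, for a fixed \<open>M\<close>, the set \<open>A\<close> of these points of the square is null.

  The inverse branches \<open>(x, y) \<mapsto> (1/(b+y), (a+x)/(b+y))\<close> of \<open>T\<close> are projective with Jacobian
  \<open>(b+y)^(-3)\<close>. Hence the densities \<open>(p x + q y + r)^(-3)\<close> form a family that is stable under
  pulling back: the branch with digits \<open>a, b\<close> turns \<open>(p, q, r)\<close> into
  \<open>(q, r, p + q a + r b)\<close> (\<open>emeasure_jp_branch\<close>). The conditions \<open>0 \<le> p, q \<le> r\<close> are
  preserved because \<open>b \<ge> 1\<close>, and on the unit square they confine the density to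
  \<open>[(3r)^(-3), r^(-3)]\<close>. This is a distortion bound that does not deteriorate under iteration,
  and it takes the place of an explicit invariant measure.

  The digits satisfy \<open>a \<le> b\<close>, and \<open>a = b\<close> forces the next point to lie on or above
  the diagonal. So two regions are needed: \<open>P\<^sub>0\<close>, the open square, and \<open>P\<^sub>1\<close>, its part
  above the diagonal. With \<open>A\<^sub>k\<close> the corresponding parts of \<open>A\<close>, the set \<open>A\<^sub>k\<close> is
  covered by the branches of the \<open>A\<^sub>j\<close> with digits \<open>b \<le> M\<close>
  (\<open>jp_bounded_orbits_above_cover\<close>), whereas the same branches of the \<open>P\<^sub>j\<close> are disjoint
  and stay in \<open>{x > 1/(M+1)}\<close> (\<open>jp_region_branches\<close>). By the distortion bound the strip
  \<open>{x \<le> 1/(M+1)}\<close> carries at least a fixed fraction \<open>\<kappa>\<close> of \<open>P\<^sub>k\<close>, for every density of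
  the family (\<open>emeasure_jp_region_loss\<close>). If \<open>\<mu> A\<^sub>k \<le> C \<mu> P\<^sub>k\<close> holds for all \<open>k\<close> and all
  densities, it therefore also holds with \<open>(1 - \<kappa>) C\<close> in place of \<open>C\<close>. Iterating gives
  \<open>\<mu> A\<^sub>k = 0\<close>.
\<close>

section \<open>The algorithm on the unit square\<close>

definition jp_map :: "real \<times> real \<Rightarrow> real \<times> real" where
  "jp_map = (\<lambda>(x, y). (frac (y / x), frac (1 / x)))"

text \<open>The inverse branch of \<open>jp_map\<close> with digits \<open>a = \<lfloor>y/x\<rfloor>\<close> and \<open>b = \<lfloor>1/x\<rfloor>\<close>.\<close>

definition jp_branch :: "real \<Rightarrow> real \<Rightarrow> real \<times> real \<Rightarrow> real \<times> real" where
  "jp_branch a b = (\<lambda>(x, y). (1 / (b + y), (a + x) / (b + y)))"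

definition jp_cell :: "nat \<Rightarrow> nat \<Rightarrow> (real \<times> real) set" where
  "jp_cell a b = {(x, y). 0 < x \<and> \<lfloor>y / x\<rfloor> = int a \<and> \<lfloor>1 / x\<rfloor> = int b}"

text \<open>The Jacobian of an iterated inverse branch is such a weight, with natural numbers
  \<open>p, q, r\<close>.\<close>

definition jp_weight :: "real \<Rightarrow> real \<Rightarrow> real \<Rightarrow> real \<times> real \<Rightarrow> real" where
  "jp_weight p q r = (\<lambda>(x, y). 1 / (p * x + q * y + r) ^ 3)"

definition jp_measure :: "real \<Rightarrow> real \<Rightarrow> real \<Rightarrow> (real \<times> real) measure" where
  "jp_measure p q r = density lborel (\<lambda>z. ennreal (jp_weight p q r z))"

text \<open>Only \<open>k = 0\<close> (the whole open square) and \<open>k = 1\<close> (the part above the diagonal) occur.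
  The strict inequalities make the branches map these regions into one another, without
  boundary points that would leave the square.\<close>

definition jp_region :: "nat \<Rightarrow> (real \<times> real) set" where
  "jp_region k = {(x, y). 0 < x \<and> x < 1 \<and> 0 < y \<and> y < 1 \<and> real k * x < y}"

definition jp_bounded_orbits :: "nat \<Rightarrow> (real \<times> real) set" where
  "jp_bounded_orbits M =
     {z \<in> {0..<1} \<times> {0..<1}. \<forall>n. 1 / real M \<le> fst ((jp_map ^^ n) z)}"

definition jp_bounded_orbits_above :: "nat \<Rightarrow> nat \<Rightarrow> (real \<times> real) set" where
  "jp_bounded_orbits_above M k = {z \<in> jp_bounded_orbits M. real k * fst z \<le> snd z}"

definition jp_digits :: "nat \<Rightarrow> nat \<Rightarrow> (nat \<times> nat) set" where
  "jp_digits M k = {(a, b). k \<le> a \<and> a \<le> b \<and> 1 \<le> b \<and> b \<le> M}"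

text \<open>The index \<open>k\<close> of the region that the next point lies in: after equal digits
  \<open>a = b\<close>, the condition \<open>y \<le> 1\<close> on the current point says that the next point is not below the
  diagonal.\<close>

definition jp_next :: "nat \<times> nat \<Rightarrow> nat" where
  "jp_next = (\<lambda>(a, b). if a = b then 1 else 0)"

lemma borel_measurable_fst_real_pair: "fst \<in> borel_measurable (borel :: (real \<times> real) measure)"
  unfolding borel_prod[symmetric] by simp

lemma jp_map_measurable [measurable]: "jp_map \<in> borel_measurable borel"
  unfolding jp_map_def frac_def case_prod_beta borel_prod[symmetric] by measurable

lemma jp_branch_measurable [measurable]: "jp_branch a b \<in> borel_measurable borel"
  unfolding jp_branch_def case_prod_beta borel_prod[symmetric] by measurable

lemma jp_weight_measurable [measurable]: "jp_weight p q r \<in> borel_measurable borel"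
  unfolding jp_weight_def case_prod_beta borel_prod[symmetric] by measurable

lemma jp_cell_sets [measurable]: "jp_cell a b \<in> sets borel"
proof -
  have "jp_cell a b = {z \<in> space (borel \<Otimes>\<^sub>M borel). 0 < fst z \<and> \<lfloor>snd z / fst z\<rfloor> = int a \<and> \<lfloor>1 / fst z\<rfloor> = int b}"
    by (auto simp: jp_cell_def space_pair_measure)
  also have "\<dots> \<in> sets (borel \<Otimes>\<^sub>M borel)"
    by measurable
  finally show ?thesis by (simp only: borel_prod)
qed

lemma jp_region_sets [measurable]: "jp_region k \<in> sets borel"
proof -
  have "jp_region k = {z \<in> space (borel \<Otimes>\<^sub>M borel). 0 < fst z \<and> fst z < 1 \<and> 0 < snd z \<and> snd z < 1 \<and> real k * fst z < snd z}"
    by (auto simp: jp_region_def space_pair_measure)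
  also have "\<dots> \<in> sets (borel \<Otimes>\<^sub>M borel)"
    by measurable
  finally show ?thesis by (simp only: borel_prod)
qed

lemma jp_bounded_orbits_above_sets [measurable]: "jp_bounded_orbits_above M k \<in> sets borel"
proof -
  have [measurable]: "jp_map ^^ n \<in> borel_measurable borel" for n
    by (induction n) (auto intro: measurable_comp)
  have [measurable]: "jp_map ^^ n \<in> borel \<Otimes>\<^sub>M borel \<rightarrow>\<^sub>M borel \<Otimes>\<^sub>M borel" for n
    by (simp add: borel_prod)
  have "jp_bounded_orbits_above M k = {z \<in> space (borel \<Otimes>\<^sub>M borel).
     0 \<le> fst z \<and> fst z < 1 \<and> 0 \<le> snd z \<and> snd z < 1 \<and> real k * fst z \<le> snd z \<and>
     (\<forall>n. 1 / real M \<le> fst ((jp_map ^^ n) z))}"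
    by (auto simp: jp_bounded_orbits_def jp_bounded_orbits_above_def space_pair_measure)
  also have "\<dots> \<in> sets (borel \<Otimes>\<^sub>M borel)"
    by measurable
  finally show ?thesis by (simp only: borel_prod)
qed

lemma jp_region_subset: "jp_region k \<subseteq> {0..<1} \<times> {0..<1}"
  by (auto simp: jp_region_def)

lemma jp_bounded_orbits_above_subset: "jp_bounded_orbits_above M k \<subseteq> {0..<1} \<times> {0..<1}"
  by (auto simp: jp_bounded_orbits_above_def jp_bounded_orbits_def)

lemma finite_jp_digits: "finite (jp_digits M k)"
  by (rule finite_subset[of _ "{..M} \<times> {..M}"]) (auto simp: jp_digits_def)

lemma sets_jp_measure [simp, measurable_cong]: "sets (jp_measure p q r) = sets borel"
  by (simp add: jp_measure_def)

lemma emeasure_jp_measure: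
  assumes "S \<in> sets borel"
  shows "emeasure (jp_measure p q r) S
    = (\<integral>\<^sup>+z. ennreal (jp_weight p q r z * indicator S z) \<partial>lborel)"
  using assms unfolding jp_measure_def
  by (subst emeasure_density) (auto intro!: nn_integral_cong simp: indicator_def)

section \<open>Change of variables along an inverse branch\<close>

text \<open>The substitution rule for integrals wants an increasing function, so \<open>y \<mapsto> 1/(b+y)\<close>
  is composed with the reflection \<open>y = -z\<close>.\<close>

lemma nn_integral_reciprocal:
  fixes f :: "real \<Rightarrow> real" and b :: real
  assumes [measurable]: "f \<in> borel_measurable borel" and b: "b > 0"
  shows "(\<integral>\<^sup>+s. ennreal (f s * indicator {1/(b+1)..1/b} s) \<partial>lborel)
       = (\<integral>\<^sup>+y. ennreal (f (1/(b+y)) / (b+y)^2 * indicator {0..1} y) \<partial>lborel)"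
proof -
  let ?g = "\<lambda>z. 1 / (b - z)" and ?g' = "\<lambda>z. 1 / (b - z)^2"
  have "(\<integral>\<^sup>+s. ennreal (f s * indicator {?g (-1)..?g 0} s) \<partial>lborel)
      = (\<integral>\<^sup>+z. ennreal (f (?g z) * ?g' z * indicator {-1..0} z) \<partial>lborel)"
  proof (rule nn_integral_substitution)
    show "(?g has_real_derivative ?g' x) (at x)" if "x \<in> {-1..0}" for x
      using that b by (auto intro!: derivative_eq_intros simp: power2_eq_square)
    show "continuous_on {-1..0} ?g'"
      using b by (intro continuous_intros) auto
  qed (auto simp: set_borel_measurable_def)
  also have "\<dots> = (\<integral>\<^sup>+y. ennreal (f (?g (0 + (-1)*y)) * ?g' (0 + (-1)*y) * indicator {-1..0} (0 + (-1)*y)) \<partial>lborel)"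
    by (subst nn_integral_real_affine[where c="-1" and t=0]) simp_all
  also have "\<dots> = (\<integral>\<^sup>+y. ennreal (f (1/(b+y)) / (b+y)^2 * indicator {0..1} y) \<partial>lborel)"
    by (intro nn_integral_cong) (auto simp: indicator_def)
  finally show ?thesis by (simp add: add.commute)
qed

text \<open>A branch is the composition of two maps that each change one coordinate: for fixed \<open>s\<close>
  the affine substitution \<open>t = s (a + x)\<close>, which contributes the factor \<open>s\<close>, and then for fixed
  \<open>x\<close> the substitution \<open>s = 1/(b+y)\<close>. The second contributes \<open>(b+y)^(-2)\<close>, which with
  \<open>s = 1/(b+y)\<close> makes the Jacobian \<open>(b+y)^(-3)\<close>.\<close>

lemma nn_integral_jp_branch:
  fixes f :: "real \<times> real \<Rightarrow> real" and a b :: real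
  assumes f [measurable]: "f \<in> borel_measurable borel" and b: "b > 0"
    and supp: "\<And>s t. s \<notin> {1/(b+1)..1/b} \<Longrightarrow> f (s, t) = 0"
  shows "(\<integral>\<^sup>+z. ennreal (f z) \<partial>lborel)
       = (\<integral>\<^sup>+z. ennreal (f (jp_branch a b z) / (b + snd z)^3 * indicator {0..1} (snd z)) \<partial>lborel)"
proof -
  have f' [measurable]: "f \<in> borel_measurable (borel \<Otimes>\<^sub>M borel)"
    by (simp add: borel_prod)
  have g [measurable]: "jp_branch a b \<in> borel \<Otimes>\<^sub>M borel \<rightarrow>\<^sub>M borel \<Otimes>\<^sub>M borel"
    by (simp add: borel_prod)
  have "(\<integral>\<^sup>+z. ennreal (f z) \<partial>lborel) = (\<integral>\<^sup>+s. \<integral>\<^sup>+t. ennreal (f (s, t)) \<partial>lborel \<partial>lborel)"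
    unfolding lborel_prod[symmetric] by (subst lborel.nn_integral_fst) simp_all
  also have "\<dots> = (\<integral>\<^sup>+s. \<integral>\<^sup>+x. ennreal (s * f (s, s * (a + x)) * indicator {1/(b+1)..1/b} s) \<partial>lborel \<partial>lborel)"
  proof (rule nn_integral_cong)
    fix s :: real
    show "(\<integral>\<^sup>+t. ennreal (f (s, t)) \<partial>lborel)
      = (\<integral>\<^sup>+x. ennreal (s * f (s, s * (a + x)) * indicator {1/(b+1)..1/b} s) \<partial>lborel)"
    proof (cases "s \<in> {1/(b+1)..1/b}")
      case True
      then have s: "s > 0"
        using b by (smt (verit) atLeastAtMost_iff divide_pos_pos)
      have "(\<integral>\<^sup>+t. ennreal (f (s, t)) \<partial>lborel)
          = ennreal s * (\<integral>\<^sup>+x. ennreal (f (s, s * a + s * x)) \<partial>lborel)"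
        using s by (subst nn_integral_real_affine[where c=s and t="s*a"]) simp_all
      also have "\<dots> = (\<integral>\<^sup>+x. ennreal s * ennreal (f (s, s * a + s * x)) \<partial>lborel)"
        by (rule nn_integral_cmult[symmetric]) simp
      finally show ?thesis
        using True s by (simp add: ennreal_mult' distrib_left)
    qed (simp add: supp)
  qed
  also have "\<dots> = (\<integral>\<^sup>+x. \<integral>\<^sup>+s. ennreal (s * f (s, s * (a + x)) * indicator {1/(b+1)..1/b} s) \<partial>lborel \<partial>lborel)"
    by (rule lborel_pair.Fubini'[symmetric]) simp
  also have "\<dots> = (\<integral>\<^sup>+x. \<integral>\<^sup>+y. ennreal ((1/(b+y)) * f (1/(b+y), 1/(b+y) * (a + x)) / (b+y)^2 * indicator {0..1} y) \<partial>lborel \<partial>lborel)"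
    by (intro nn_integral_cong nn_integral_reciprocal[of "\<lambda>s. s * f (s, s * (a + x))" for x] b) simp
  also have "\<dots> = (\<integral>\<^sup>+x. \<integral>\<^sup>+y. (\<lambda>z. ennreal (f (jp_branch a b z) / (b + snd z)^3 * indicator {0..1} (snd z))) (x, y) \<partial>lborel \<partial>lborel)"
    by (intro nn_integral_cong) (simp add: jp_branch_def power2_eq_square power3_eq_cube mult_ac)
  also have "\<dots> = (\<integral>\<^sup>+z. ennreal (f (jp_branch a b z) / (b + snd z)^3 * indicator {0..1} (snd z)) \<partial>lborel)"
    unfolding lborel_prod[symmetric] by (subst lborel.nn_integral_fst) simp_all
  finally show ?thesis .
qed

lemma jp_map_branch:
  assumes "0 \<le> x" "x < 1" "0 \<le> y" "y < 1" "1 \<le> b"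
  shows "jp_map (jp_branch (real a) (real b) (x, y)) = (x, y)"
    and "jp_branch (real a) (real b) (x, y) \<in> jp_cell a b"
proof -
  have "real b + y > 0" using assms by simp
  then have branch: "jp_branch a b (x, y) = (1 / (b + y), (a + x) / (b + y))"
      "(a + x) / (b + y) / (1 / (b + y)) = a + x"
    by (simp_all add: jp_branch_def)
  show "jp_map (jp_branch a b (x, y)) = (x, y)"
    using assms by (simp add: jp_map_def branch frac_unique_iff)
  show "jp_branch a b (x, y) \<in> jp_cell a b"
    using assms \<open>real b + y > 0\<close> by (simp add: jp_cell_def branch floor_eq_iff)
qed

text \<open>The denominator \<open>b + y\<close> of the branch cancels against the Jacobian, because the weight is
  the inverse cube of an affine form; this is why the exponent is 3.\<close>

lemma emeasure_jp_branch:
  assumes R [measurable]: "R \<in> sets borel" and R01: "R \<subseteq> {0..<1} \<times> {0..<1}" and b: "1 \<le> b"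
  shows "emeasure (jp_measure p q r) (jp_cell a b \<inter> jp_map -` R)
       = emeasure (jp_measure q r (p + q * real a + r * real b)) R"
proof -
  let ?S = "jp_cell a b \<inter> jp_map -` R"
  let ?f = "\<lambda>z. jp_weight p q r z * indicator ?S z"
  have S [measurable]: "?S \<in> sets borel"
    using measurable_sets[OF jp_map_measurable R] by (intro sets.Int) auto
  have "emeasure (jp_measure p q r) ?S = (\<integral>\<^sup>+z. ennreal (?f z) \<partial>lborel)"
    by (rule emeasure_jp_measure) simp
  also have "\<dots> = (\<integral>\<^sup>+z. ennreal (?f (jp_branch a b z) / (b + snd z)^3 * indicator {0..1} (snd z)) \<partial>lborel)"
  proof (rule nn_integral_jp_branch)
    fix s t :: real
    assume s: "s \<notin> {1/(real b+1)..1/real b}"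
    have False if "(s, t) \<in> ?S"
    proof -
      from that have "0 < s" "real b \<le> 1 / s" "1 / s < real b + 1"
        by (auto simp: jp_cell_def floor_eq_iff)
      with s b show False by (auto simp: field_simps)
    qed
    then show "?f (s, t) = 0" by (auto simp: indicator_def)
  qed (use b in simp_all)
  also have "\<dots> = (\<integral>\<^sup>+z. ennreal (jp_weight q r (p + q * real a + r * real b) z * indicator R z) \<partial>lborel)"
  proof (rule nn_integral_cong)
    fix z :: "real \<times> real"
    obtain x y where z: "z = (x, y)" by force
    have ind: "indicator ?S (jp_branch a b (x, y)) * indicator {0..1} y = (indicator R (x, y) :: real)"
    proof (cases "(x, y) \<in> R")
      case True
      then have "0 \<le> x" "x < 1" "0 \<le> y" "y < 1" using R01 by auto
      then show ?thesis using True jp_map_branch[of x y b a] b by auto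
    next
      case False
      have False if "jp_branch a b (x, y) \<in> ?S" "y \<in> {0..1}"
      proof -
        have "\<lfloor>real b + y\<rfloor> = int b" "\<lfloor>real a + x\<rfloor> = int a"
          using that b by (auto simp: jp_cell_def jp_branch_def)
        then have "0 \<le> x" "x < 1" "0 \<le> y" "y < 1" by (auto simp: floor_eq_iff)
        then show False using that False jp_map_branch[of x y b a] b by auto
      qed
      then show ?thesis using False by (auto simp: indicator_def)
    qed
    have w: "jp_weight p q r (jp_branch a b (x, y)) / (b + y)^3 = jp_weight q r (p + q * real a + r * real b) (x, y)"
      if "y \<in> {0..1}"
    proof -
      have "real b + y \<noteq> 0" using that b by auto
      moreover have "p * (1 / c) + q * ((a + x) / c) + r = (p + q * (a + x) + r * c) / c"
        if "c \<noteq> 0" for c :: real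
        using that by (simp add: field_simps)
      ultimately have "p * (1 / (b + y)) + q * ((a + x) / (b + y)) + r
        = (p + q * (a + x) + r * (b + y)) / (b + y)"
        by blast
      also have "\<dots> = (q * x + r * y + (p + q * real a + r * real b)) / (b + y)"
        by (simp add: algebra_simps)
      finally have "p * (1 / (b + y)) + q * ((a + x) / (b + y)) + r
        = (q * x + r * y + (p + q * real a + r * real b)) / (b + y)" .
      then have "jp_weight p q r (jp_branch a b (x, y))
        = 1 / ((q * x + r * y + (p + q * real a + r * real b)) / (b + y)) ^ 3"
        by (simp only: jp_weight_def jp_branch_def prod.case)
      then show ?thesis
        using \<open>real b + y \<noteq> 0\<close> by (simp add: jp_weight_def power_divide)
    qed
    show "ennreal (?f (jp_branch a b z) / (b + snd z)^3 * indicator {0..1} (snd z))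
      = ennreal (jp_weight q r (p + q * real a + r * real b) z * indicator R z)"
      unfolding z ind[symmetric] using w by (auto simp: indicator_def)
  qed
  also have "\<dots> = emeasure (jp_measure q r (p + q * real a + r * real b)) R"
    by (rule emeasure_jp_measure[symmetric]) simp
  finally show ?thesis .
qed

section \<open>Digits\<close>

text \<open>Every point of \<open>A\<^sub>k\<close> has digits \<open>k \<le> a \<le> b \<le> M\<close>: the lower bound comes from
  \<open>k x \<le> y\<close>, the middle one from \<open>y < 1\<close>, the upper one from \<open>x \<ge> 1/M\<close>.\<close>

lemma jp_bounded_orbits_above_cover:
  assumes M: "M > 0" and k: "k \<le> 1"
  shows "jp_bounded_orbits_above M k \<subseteq>
    (\<Union>d\<in>jp_digits M k. jp_cell (fst d) (snd d) \<inter> jp_map -` jp_bounded_orbits_above M (jp_next d))"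
proof (rule subrelI)
  fix x y
  assume xy: "(x, y) \<in> jp_bounded_orbits_above M k"
  then have *: "0 \<le> x" "x < 1" "0 \<le> y" "y < 1" "real k * x \<le> y"
    and orb: "\<And>n. 1 / real M \<le> fst ((jp_map ^^ n) (x, y))"
    by (auto simp: jp_bounded_orbits_above_def jp_bounded_orbits_def)
  have xM: "1 / real M \<le> x" using orb[of 0] by simp
  have "0 < 1 / real M" using M by simp
  with xM have x: "0 < x" by linarith
  define a b where "a = nat \<lfloor>y / x\<rfloor>" and "b = nat \<lfloor>1 / x\<rfloor>"
  have a: "\<lfloor>y / x\<rfloor> = int a" and b: "\<lfloor>1 / x\<rfloor> = int b"
    using x * by (auto simp: a_def b_def)
  have "y / x \<le> 1 / x" using x * by (simp add: divide_right_mono)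
  then have ab: "a \<le> b" using floor_mono a b by fastforce
  have "1 \<le> 1 / x" using x * by simp
  then have b1: "1 \<le> b" using floor_mono b by fastforce
  have "1 / x \<le> real M" using x xM M by (simp add: field_simps)
  then have bM: "b \<le> M" using floor_mono b by fastforce
  have "real k \<le> y / x" using x * by (simp add: field_simps)
  then have ka: "k \<le> a" using floor_mono a by fastforce
  have map: "jp_map (x, y) = (y / x - real a, 1 / x - real b)"
    by (simp add: jp_map_def frac_def a b)
  have "jp_map (x, y) \<in> jp_bounded_orbits M"
  proof -
    have "1 / real M \<le> fst ((jp_map ^^ n) (jp_map (x, y)))" for n
      using orb[of "Suc n"] by (simp add: funpow_swap1)
    then show ?thesis
      by (auto simp: jp_bounded_orbits_def jp_map_def frac_lt_1)
  qed
  moreover have "real (jp_next (a, b)) * fst (jp_map (x, y)) \<le> snd (jp_map (x, y))"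
  proof (cases "a = b")
    case True
    then show ?thesis using \<open>y / x \<le> 1 / x\<close> by (simp add: map jp_next_def)
  next
    case False
    then show ?thesis by (simp add: jp_next_def jp_map_def)
  qed
  ultimately have "(x, y) \<in> jp_cell a b \<inter> jp_map -` jp_bounded_orbits_above M (jp_next (a, b))"
    using x a b by (simp add: jp_cell_def jp_bounded_orbits_above_def)
  moreover have "(a, b) \<in> jp_digits M k"
    using ab b1 bM ka by (simp add: jp_digits_def)
  ultimately show "(x, y) \<in> (\<Union>d\<in>jp_digits M k. jp_cell (fst d) (snd d) \<inter> jp_map -` jp_bounded_orbits_above M (jp_next d))"
    by force
qed

text \<open>Conversely, any admissible digits may precede a point of the region that they prescribe.
  Since \<open>1/x < b + 1 \<le> M + 1\<close>, digits \<open>b \<le> M\<close> never lead into the strip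
  \<open>x \<le> 1/(M+1)\<close>.\<close>

lemma jp_region_branches:
  assumes "d \<in> jp_digits M k"
  shows "jp_cell (fst d) (snd d) \<inter> jp_map -` jp_region (jp_next d)
     \<subseteq> {z \<in> jp_region k. 1 / (real M + 1) < fst z}"
proof (rule subrelI)
  fix x y
  assume "(x, y) \<in> jp_cell (fst d) (snd d) \<inter> jp_map -` jp_region (jp_next d)"
  then have xy: "(x, y) \<in> jp_cell (fst d) (snd d)" and reg: "jp_map (x, y) \<in> jp_region (jp_next d)"
    by auto
  obtain a b where d: "d = (a, b)" by force
  have x: "0 < x" and ab: "\<lfloor>y / x\<rfloor> = int a" "\<lfloor>1 / x\<rfloor> = int b"
    using xy by (auto simp: d jp_cell_def)
  have dig: "k \<le> a" "a \<le> b" "1 \<le> b" "b \<le> M" using assms by (auto simp: d jp_digits_def)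
  have map: "jp_map (x, y) = (y / x - real a, 1 / x - real b)"
    by (simp add: jp_map_def frac_def ab)
  have r: "0 < y / x - real a" "y / x - real a < 1" "0 < 1 / x - real b" "1 / x - real b < 1"
    "a = b \<Longrightarrow> y / x - real a < 1 / x - real b"
    using reg by (auto simp: map jp_region_def jp_next_def d)
  have "1 < 1 / x" using r dig by linarith
  then have "x < 1" using x by (simp add: field_simps)
  moreover have "1 / x < real M + 1" using r dig by linarith
  then have "1 / (real M + 1) < x" using x by (simp add: field_simps)
  moreover have "y / x < 1 / x"
  proof (cases "a = b")
    case False
    then have "real a + 1 \<le> real b" using dig by linarith
    then show ?thesis using r by linarith
  qed (use r in simp)
  then have "y < 1" using x by (simp add: field_simps)
  moreover have "real k < y / x" using r dig by linarith
  then have "real k * x < y" using x by (simp add: field_simps)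
  moreover have "0 < y" using \<open>real k * x < y\<close> x
    by (smt (verit) mult_nonneg_nonneg of_nat_0_le_iff)
  ultimately show "(x, y) \<in> {z \<in> jp_region k. 1 / (real M + 1) < fst z}"
    using x by (simp add: jp_region_def)
qed

section \<open>Bounded distortion and the loss of mass\<close>

lemma jp_weight_bounds:
  assumes "0 \<le> p" "p \<le> r" "0 \<le> q" "q \<le> r" "0 < r" "x \<in> {0..1}" "y \<in> {0..1}"
  shows "1 / (3 * r)^3 \<le> jp_weight p q r (x, y)" "jp_weight p q r (x, y) \<le> 1 / r^3"
proof -
  have "p * x \<le> r * 1" "q * y \<le> r * 1" using assms by (intro mult_mono; simp)+
  moreover have "0 \<le> p * x" "0 \<le> q * y" using assms by auto
  ultimately have l: "r \<le> p * x + q * y + r" "p * x + q * y + r \<le> 3 * r" by auto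
  show "1 / (3 * r)^3 \<le> jp_weight p q r (x, y)"
    unfolding jp_weight_def prod.case using l \<open>0 < r\<close>
    by (intro divide_left_mono power_mono mult_pos_pos zero_less_power) auto
  show "jp_weight p q r (x, y) \<le> 1 / r^3"
    unfolding jp_weight_def prod.case using l \<open>0 < r\<close>
    by (intro divide_left_mono power_mono mult_pos_pos zero_less_power) auto
qed

lemma emeasure_lborel_rectangle:
  fixes a b c d :: real
  assumes "a \<le> b" "c \<le> d"
  shows "emeasure lborel ({a<..<b} \<times> {c<..<d}) = ennreal ((b - a) * (d - c))"
  unfolding lborel_prod[symmetric] using assms
  by (simp add: lborel.emeasure_pair_measure_Times ennreal_mult)

lemma emeasure_jp_measure_le:
  assumes c: "0 \<le> p" "p \<le> r" "0 \<le> q" "q \<le> r" "0 < r"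
    and S: "S \<in> sets borel" "S \<subseteq> {0..1} \<times> {0..1}"
  shows "emeasure (jp_measure p q r) S \<le> ennreal (1 / r^3)"
proof -
  have "emeasure (jp_measure p q r) S \<le> (\<integral>\<^sup>+z. ennreal (1 / r^3) * indicator ({0..1::real} \<times> {0..1::real}) z \<partial>lborel)"
    unfolding emeasure_jp_measure[OF S(1)]
  proof (rule nn_integral_mono)
    fix z
    show "ennreal (jp_weight p q r z * indicator S z) \<le> ennreal (1 / r^3) * indicator ({0..1} \<times> {0..1}) z"
    proof (cases "z \<in> S")
      case True
      obtain x y where z: "z = (x, y)" by force
      have "x \<in> {0..1}" "y \<in> {0..1}" using True S(2) z by auto
      then show ?thesis using True jp_weight_bounds(2)[OF c, of x y] z
        by (simp add: ennreal_leI)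
    qed simp
  qed
  also have "\<dots> = ennreal (1 / r^3) * emeasure lborel ({0..1::real} \<times> {0..1::real})"
    by (rule nn_integral_cmult_indicator) (simp add: borel_closed closed_Times)
  also have "emeasure lborel ({0..1::real} \<times> {0..1::real}) = 1"
    unfolding lborel_prod[symmetric] by (simp add: lborel.emeasure_pair_measure_Times)
  finally show ?thesis by simp
qed

text \<open>The strip contains the rectangle \<open>0 < x < 1/(M+1)\<close>, \<open>1/2 < y < 1\<close>, which lies above the
  diagonal as \<open>M \<ge> 1\<close>. Its area \<open>1/(2(M+1))\<close> times the least weight \<open>1/(27 r^3)\<close> gives the
  constant.\<close>

lemma emeasure_jp_region_near_axis:
  assumes c: "0 \<le> p" "p \<le> r" "0 \<le> q" "q \<le> r" "0 < r" and M: "M > 0" and k: "k \<le> 1"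
  shows "ennreal (1 / (54 * (real M + 1)) * (1 / r^3))
    \<le> emeasure (jp_measure p q r) {z \<in> jp_region k. fst z \<le> 1 / (real M + 1)}"
proof -
  let ?m = "1 / (real M + 1)"
  let ?R = "{0<..<?m} \<times> {1/2<..<1::real}" and ?S = "{z \<in> jp_region k. fst z \<le> ?m}"
  have m: "?m \<le> 1 / 2" using M by (simp add: field_simps)
  have [measurable]: "?R \<in> sets borel" by (simp add: borel_open open_Times)
  note borel_measurable_fst_real_pair [measurable]
  have [measurable]: "?S \<in> sets borel" by measurable
  have sub: "?R \<subseteq> ?S"
  proof (rule subrelI)
    fix x y :: real assume "(x, y) \<in> ?R"
    then have xy: "x \<in> {0<..<?m}" "y \<in> {1/2<..<1}" by auto
    have "real k * x \<le> 1 * x" using k xy by (intro mult_right_mono) auto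
    moreover have "0 < x" "x < ?m" "1 / 2 < y" "y < 1" using xy by auto
    ultimately have "x < 1" "0 < y" "real k * x < y" "x \<le> ?m" using m by linarith+
    then show "(x, y) \<in> ?S" using \<open>0 < x\<close> \<open>y < 1\<close> by (simp add: jp_region_def)
  qed
  have "ennreal (1 / (54 * (real M + 1)) * (1 / r^3)) = ennreal (1 / (3 * r)^3) * ennreal ((?m - 0) * (1 - 1/2))"
    using c by (subst ennreal_mult'[symmetric]) (auto simp: power_mult_distrib field_simps)
  also have "\<dots> = ennreal (1 / (3 * r)^3) * emeasure lborel ?R"
    by (subst emeasure_lborel_rectangle) auto
  also have "\<dots> = (\<integral>\<^sup>+z. ennreal (1 / (3 * r)^3) * indicator ?R z \<partial>lborel)"
    by (rule nn_integral_cmult_indicator[symmetric]) simp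
  also have "\<dots> \<le> emeasure (jp_measure p q r) ?R"
    unfolding emeasure_jp_measure[OF \<open>?R \<in> sets borel\<close>]
  proof (rule nn_integral_mono)
    fix z
    show "ennreal (1 / (3 * r)^3) * indicator ?R z \<le> ennreal (jp_weight p q r z * indicator ?R z)"
    proof (cases "z \<in> ?R")
      case True
      obtain x y where z: "z = (x, y)" by force
      have "0 < x" "x < ?m" "0 < y" "y < 1" using True z by auto
      with m have "x \<in> {0..1}" "y \<in> {0..1}" unfolding atLeastAtMost_iff by linarith+
      then show ?thesis using True jp_weight_bounds(1)[OF c, of x y] z
        by (simp add: ennreal_leI)
    qed simp
  qed
  also have "\<dots> \<le> emeasure (jp_measure p q r) ?S"
    by (rule emeasure_mono[OF sub]) simp
  finally show ?thesis .
qed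

text \<open>The total mass of the region is at most \<open>r^(-3)\<close>, so the bound of the previous lemma is a
  fixed fraction of it, uniformly in \<open>p, q, r\<close>.\<close>

lemma emeasure_jp_region_loss:
  assumes c: "0 \<le> p" "p \<le> r" "0 \<le> q" "q \<le> r" "0 < r" and M: "M > 0" and k: "k \<le> 1"
  shows "emeasure (jp_measure p q r) {z \<in> jp_region k. 1 / (real M + 1) < fst z}
    \<le> ennreal (1 - 1 / (54 * (real M + 1))) * emeasure (jp_measure p q r) (jp_region k)"
proof -
  let ?\<mu> = "jp_measure p q r"
  let ?far = "{z \<in> jp_region k. 1 / (real M + 1) < fst z}"
  let ?near = "{z \<in> jp_region k. fst z \<le> 1 / (real M + 1)}"
  define \<kappa> where "\<kappa> = 1 / (54 * (real M + 1))"
  have \<kappa>: "0 < \<kappa>" "\<kappa> < 1" by (auto simp: \<kappa>_def field_simps)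
  note borel_measurable_fst_real_pair [measurable]
  have [measurable]: "?far \<in> sets borel" "?near \<in> sets borel" by measurable
  have split: "emeasure ?\<mu> ?far + emeasure ?\<mu> ?near = emeasure ?\<mu> (jp_region k)"
    by (subst plus_emeasure) (auto intro!: arg_cong[where f = "emeasure ?\<mu>"])
  have le: "emeasure ?\<mu> (jp_region k) \<le> ennreal (1 / r^3)"
    using jp_region_subset[of k] by (intro emeasure_jp_measure_le[OF c] jp_region_sets) auto
  have near: "ennreal (\<kappa> * (1 / r^3)) \<le> emeasure ?\<mu> ?near"
    unfolding \<kappa>_def by (rule emeasure_jp_region_near_axis[OF c M k])
  have fin: "emeasure ?\<mu> (jp_region k) < top"
    using le by (simp add: le_less_trans)
  define F N where "F = enn2real (emeasure ?\<mu> ?far)" and "N = enn2real (emeasure ?\<mu> ?near)"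
  have "emeasure ?\<mu> ?far < top" "emeasure ?\<mu> ?near < top"
    using fin split by (auto simp: ennreal_add_eq_top less_top[symmetric])
  then have F: "emeasure ?\<mu> ?far = ennreal F" and N: "emeasure ?\<mu> ?near = ennreal N"
    by (auto simp: F_def N_def)
  have nn: "0 \<le> F" "0 \<le> N" by (auto simp: F_def N_def)
  have J: "emeasure ?\<mu> (jp_region k) = ennreal (F + N)"
    using split nn by (simp add: F N)
  have "F + N \<le> 1 / r^3" using le c by (simp add: J del: ennreal_plus)
  then have "\<kappa> * (F + N) \<le> \<kappa> * (1 / r^3)" using \<kappa> by (intro mult_left_mono) auto
  also have "\<dots> \<le> N" using near nn by (simp add: N)
  finally have "F \<le> (1 - \<kappa>) * (F + N)" by (simp add: algebra_simps)
  then show ?thesis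
    using \<kappa> nn unfolding F J \<kappa>_def[symmetric] by (subst ennreal_mult[symmetric]) auto
qed

section \<open>Bounded orbits are negligible\<close>

text \<open>The estimate is uniform in \<open>k\<close> and in the weight because the induction step applies it to all
  the pulled-back weights \<open>(q, r, p + q a + r b)\<close> and to both regions. For \<open>n = 0\<close> it
  compares the trivial bound \<open>r^(-3)\<close> with the mass \<open>\<kappa> r^(-3)\<close> of the strip.\<close>

lemma emeasure_jp_bounded_orbits_decay:
  assumes M: "M > 0" and "k \<le> 1" "0 \<le> p" "p \<le> r" "0 \<le> q" "q \<le> r" "0 < r"
  defines "\<kappa> \<equiv> 1 / (54 * (real M + 1))"
  shows "emeasure (jp_measure p q r) (jp_bounded_orbits_above M k)
     \<le> ennreal (1 / \<kappa> * (1 - \<kappa>) ^ n) * emeasure (jp_measure p q r) (jp_region k)"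
  using assms(2-7)
proof (induction n arbitrary: k p q r)
  case 0
  have \<kappa>: "0 < \<kappa>" by (auto simp: \<kappa>_def)
  have "emeasure (jp_measure p q r) (jp_bounded_orbits_above M k) \<le> ennreal (1 / r^3)"
    using 0 jp_bounded_orbits_above_subset[of M k]
    by (intro emeasure_jp_measure_le jp_bounded_orbits_above_sets) auto
  also have "\<dots> = ennreal (1 / \<kappa>) * ennreal (\<kappa> * (1 / r^3))"
    using \<kappa> 0 by (subst ennreal_mult'[symmetric]) auto
  also have "\<dots> \<le> ennreal (1 / \<kappa>) * emeasure (jp_measure p q r) {z \<in> jp_region k. fst z \<le> 1 / (real M + 1)}"
    unfolding \<kappa>_def using 0 M by (intro mult_left_mono emeasure_jp_region_near_axis) auto
  also have "\<dots> \<le> ennreal (1 / \<kappa>) * emeasure (jp_measure p q r) (jp_region k)"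
    by (intro mult_left_mono emeasure_mono) auto
  finally show ?case by simp
next
  case (Suc n)
  let ?c = "1 / \<kappa> * (1 - \<kappa>) ^ n"
  let ?A = "jp_bounded_orbits_above M" and ?\<mu> = "jp_measure p q r"
  let ?\<nu> = "\<lambda>d. jp_measure q r (p + q * real (fst d) + r * real (snd d))"
  let ?B = "\<lambda>R d. jp_cell (fst d) (snd d) \<inter> jp_map -` R (jp_next d)"
  have \<kappa>: "0 < \<kappa>" "\<kappa> < 1" by (auto simp: \<kappa>_def field_simps)
  note borel_measurable_fst_real_pair [measurable]
  have meas: "?B R d \<in> sets borel" if "\<And>j. R j \<in> sets borel" for R d
    using measurable_sets[OF jp_map_measurable that] by (intro sets.Int) auto
  have pull: "emeasure ?\<mu> (?B R d) = emeasure (?\<nu> d) (R (jp_next d))"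
    if "d \<in> jp_digits M k" "R (jp_next d) \<in> sets borel" "R (jp_next d) \<subseteq> {0..<1} \<times> {0..<1}" for R d
    using that by (intro emeasure_jp_branch) (auto simp: jp_digits_def)
  \<comment> \<open>The induction hypothesis applies to the pulled-back weight since \<open>b \<ge> 1\<close> makes its last
     coefficient at least \<open>r\<close>, hence at least \<open>q\<close> as well.\<close>
  have step: "emeasure (?\<nu> d) (?A (jp_next d)) \<le> ennreal ?c * emeasure (?\<nu> d) (jp_region (jp_next d))"
    if d: "d \<in> jp_digits M k" for d
  proof (rule Suc.IH)
    have "r * 1 \<le> r * real (snd d)"
      using d Suc.prems by (intro mult_left_mono) (auto simp: jp_digits_def)
    moreover have "0 \<le> q * real (fst d)" using Suc.prems by simp
    ultimately have r: "r \<le> p + q * real (fst d) + r * real (snd d)" using Suc.prems by linarith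
    show "r \<le> p + q * real (fst d) + r * real (snd d)" by (fact r)
    show "q \<le> p + q * real (fst d) + r * real (snd d)" using r Suc.prems by linarith
    show "0 < p + q * real (fst d) + r * real (snd d)" using r Suc.prems by linarith
    show "jp_next d \<le> 1" by (simp add: jp_next_def split: prod.split)
  qed (use Suc.prems in auto)
  have "emeasure ?\<mu> (?A k) \<le> emeasure ?\<mu> (\<Union>d\<in>jp_digits M k. ?B ?A d)"
    using jp_bounded_orbits_above_cover[OF M, of k] Suc.prems meas[of ?A]
    by (intro emeasure_mono) (auto intro!: sets.finite_UN finite_jp_digits)
  also have "\<dots> \<le> (\<Sum>d\<in>jp_digits M k. emeasure ?\<mu> (?B ?A d))"
    using meas[of ?A] by (intro emeasure_subadditive_finite finite_jp_digits) auto
  also have "\<dots> = (\<Sum>d\<in>jp_digits M k. emeasure (?\<nu> d) (?A (jp_next d)))"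
    by (intro sum.cong refl pull jp_bounded_orbits_above_sets jp_bounded_orbits_above_subset)
  also have "\<dots> \<le> (\<Sum>d\<in>jp_digits M k. ennreal ?c * emeasure (?\<nu> d) (jp_region (jp_next d)))"
    by (intro sum_mono step)
  also have "\<dots> = ennreal ?c * (\<Sum>d\<in>jp_digits M k. emeasure ?\<mu> (?B jp_region d))"
    unfolding sum_distrib_left by (intro sum.cong refl arg_cong2[where f="(*)"] pull[symmetric]
        jp_region_sets jp_region_subset)
  also have "(\<Sum>d\<in>jp_digits M k. emeasure ?\<mu> (?B jp_region d)) = emeasure ?\<mu> (\<Union>d\<in>jp_digits M k. ?B jp_region d)"
    using meas[of jp_region]
    by (intro sum_emeasure finite_jp_digits) (auto simp: disjoint_family_on_def jp_cell_def)
  also have "\<dots> \<le> emeasure ?\<mu> {z \<in> jp_region k. 1 / (real M + 1) < fst z}"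
    using jp_region_branches[of _ M k] by (intro emeasure_mono UN_least) auto
  also have "\<dots> \<le> ennreal (1 - \<kappa>) * emeasure ?\<mu> (jp_region k)"
    unfolding \<kappa>_def using Suc.prems M by (intro emeasure_jp_region_loss) auto
  also have "ennreal ?c * (ennreal (1 - \<kappa>) * emeasure ?\<mu> (jp_region k))
      = ennreal (1 / \<kappa> * (1 - \<kappa>) ^ Suc n) * emeasure ?\<mu> (jp_region k)"
    using \<kappa> by (subst mult.assoc[symmetric], subst ennreal_mult'[symmetric]) (auto simp: mult_ac)
  finally show ?case by (simp add: mult_left_mono)
qed

text \<open>For \<open>(p, q, r) = (0, 0, 1)\<close> the weighted measure is Lebesgue measure.\<close>

lemma negligible_jp_bounded_orbits:
  assumes M: "M > 0"
  shows "negligible (jp_bounded_orbits M)"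
proof -
  let ?\<mu> = "jp_measure 0 0 1" and ?A = "jp_bounded_orbits_above M 0"
  define \<kappa> where "\<kappa> = 1 / (54 * (real M + 1))"
  have \<kappa>: "0 < \<kappa>" "\<kappa> < 1" by (auto simp: \<kappa>_def field_simps)
  have \<mu>: "emeasure ?\<mu> S = emeasure lborel S" if "S \<in> sets borel" for S
    using that by (simp add: emeasure_jp_measure jp_weight_def case_prod_beta ennreal_indicator)
  have J: "emeasure ?\<mu> (jp_region 0) \<le> ennreal 1"
    using emeasure_jp_measure_le[of 0 1 0 "jp_region 0"] jp_region_subset[of 0]
    by (force simp: jp_region_sets)
  have le: "emeasure lborel ?A \<le> ennreal (1 / \<kappa> * (1 - \<kappa>) ^ n)" for n
  proof -
    have "emeasure lborel ?A \<le> ennreal (1 / \<kappa> * (1 - \<kappa>) ^ n) * emeasure ?\<mu> (jp_region 0)"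
      using emeasure_jp_bounded_orbits_decay[OF M, of 0 0 1 0 n]
      by (simp add: \<mu> \<kappa>_def)
    also have "\<dots> \<le> ennreal (1 / \<kappa> * (1 - \<kappa>) ^ n) * ennreal 1"
      by (intro mult_left_mono J) auto
    finally show ?thesis by simp
  qed
  have "(\<lambda>n. ennreal (1 / \<kappa> * (1 - \<kappa>) ^ n)) \<longlonglongrightarrow> ennreal (1 / \<kappa> * 0)"
    using \<kappa> by (intro tendsto_intros tendsto_ennrealI LIMSEQ_realpow_zero) auto
  then have "emeasure lborel ?A \<le> ennreal (1 / \<kappa> * 0)"
    by (rule LIMSEQ_le_const) (use le in auto)
  then have "?A \<in> null_sets lborel" by (auto simp: null_sets_def)
  moreover have "?A = jp_bounded_orbits M"
    by (auto simp: jp_bounded_orbits_above_def jp_bounded_orbits_def)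
  ultimately show ?thesis
    by (simp add: negligible_iff_null_sets null_sets_completionI)
qed

section \<open>From the algorithm to the map of the square\<close>

lemma jp_seq_Some_frac:
  assumes "\<And>n. jp_seq p n \<noteq> None"
  shows "\<exists>\<alpha> \<beta>. jp_seq p n = Some (\<alpha>, \<beta>) \<and> frac \<alpha> \<noteq> 0 \<and> jp_beta p (Suc n) = 1 / frac \<alpha> \<and>
    (jp_map ^^ n) (frac (fst p), frac (snd p)) = (frac \<alpha>, frac \<beta>)"
proof (induction n)
  case 0
  obtain a b where p: "p = (a, b)" by force
  show ?case using assms[of "Suc 0"]
    by (auto simp: p jp_step_def jp_beta_def split: if_splits)
next
  case (Suc n)
  then obtain a b where ab: "jp_seq p n = Some (a, b)" "frac a \<noteq> 0"
    "(jp_map ^^ n) (frac (fst p), frac (snd p)) = (frac a, frac b)" by blast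
  have seq: "jp_seq p (Suc n) = Some (frac b / frac a, 1 / frac a)"
    using ab by (simp add: jp_step_def)
  moreover have "frac (frac b / frac a) \<noteq> 0"
    using assms[of "Suc (Suc n)"] seq by (auto simp: jp_step_def simp del: jp_seq.simps(2) simp: jp_seq.simps(2)[of p "Suc n"])
  moreover have "jp_beta p (Suc (Suc n)) = 1 / frac (frac b / frac a)"
    using calculation unfolding jp_beta_def jp_seq.simps(2)[of p "Suc n"] by (simp add: jp_step_def)
  ultimately show ?case using ab by (auto simp: jp_map_def)
qed

lemma jp_bounded_subset_translates:
  "jp_bounded \<subseteq> (\<Union>M\<in>{0<..}. \<Union>c\<in>\<int> \<times> \<int>. (+) c ` jp_bounded_orbits M)"
proof
  fix p assume p: "p \<in> jp_bounded"
  then have ne: "jp_seq p n \<noteq> None" for n by (auto simp: jp_bounded_def)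
  from p obtain K where K: "jp_beta p n \<le> K" for n by (auto simp: jp_bounded_def bdd_above_def)
  define M where "M = nat \<lceil>max K 1\<rceil>"
  have M: "0 < M" "K \<le> real M" by (auto simp: M_def) linarith+
  let ?z = "(frac (fst p), frac (snd p))"
  have "1 / real M \<le> fst ((jp_map ^^ n) ?z)" for n
  proof -
    obtain \<alpha> \<beta> where ab: "frac \<alpha> \<noteq> 0" "jp_beta p (Suc n) = 1 / frac \<alpha>" "(jp_map ^^ n) ?z = (frac \<alpha>, frac \<beta>)"
      using jp_seq_Some_frac[of p n] ne by blast
    have pos: "0 < frac \<alpha>" using ab(1) frac_ge_0[of \<alpha>] by linarith
    have "1 / frac \<alpha> \<le> real M" using K[of "Suc n"] M ab by simp
    then show ?thesis using pos M by (simp add: ab(3) field_simps)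
  qed
  then have "?z \<in> jp_bounded_orbits M" by (auto simp: jp_bounded_orbits_def frac_lt_1)
  moreover have "p = (of_int \<lfloor>fst p\<rfloor>, of_int \<lfloor>snd p\<rfloor>) + ?z" by (simp add: frac_def prod_eq_iff)
  ultimately show "p \<in> (\<Union>M\<in>{0<..}. \<Union>c\<in>\<int> \<times> \<int>. (+) c ` jp_bounded_orbits M)"
    using M(1) by (intro UN_I[of M] UN_I[of "(of_int \<lfloor>fst p\<rfloor>, of_int \<lfloor>snd p\<rfloor>)"]
      image_eqI[where x = ?z]) auto
qed

theorem theorem4p4: "jp_bounded \<in> null_sets (lebesgue :: (real \<times> real) measure)"
proof -
  have "countable (\<int> :: real set)" by (simp add: Ints_def)
  then have "countable (\<int> \<times> \<int> :: (real \<times> real) set)" by simp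
  then have "negligible (\<Union>M\<in>{0<..}. \<Union>c\<in>\<int> \<times> \<int>. (+) c ` jp_bounded_orbits M)"
    by (intro negligible_countable_Union) (auto intro!: negligible_countable_Union negligible_translation negligible_jp_bounded_orbits)
  then have "negligible jp_bounded"
    by (rule negligible_subset[OF _ jp_bounded_subset_translates])
  then show ?thesis by (simp add: negligible_iff_null_sets)
qed

end
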